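(* Let $\mathcal{B}$ be the collection of all homothetic copies $a+rS$ ($a\in\mathbb{R}$, $r>0$) of sets $S\subset\mathbb{R}$ of the form $$S=\big((0,1)\cup(x,x+\epsilon)\big)\cap(0,2),\qquad x\in\mathbb{R},\ 0<\epsilon<1.$$ Then $\mathcal{B}$ is a homothecy invariant density basis, and its halo function $\phi:[0,\infty)\to[0,\infty]$ is not continuous at $1$.
   Context: $|\cdot|$ denotes Lebesgue measure on $\mathbb{R}$ and $\chi_A$ the characteristic function of $A$. A collection $\mathcal{B}$ of sets is homothecy invariant if for every $R\in\mathcal{B}$, $r>0$ and $a\in\mathbb{R}$, the set $a+rR$ also belongs to $\mathcal{B}$. A collection $\mathcal{B}$ of open sets in $\mathbb{R}$ such that every $x\in\mathbb{R}$ is contained in members of $\mathcal{B}$ of arbitrarily small diameter is called a density basis if, for every measurable $A\subset\mathbb{R}$, for almost every $x\in\mathbb{R}$ one has $\lim_{k\to\infty}\frac{1}{|R_k|}\int_{R_k}\chi_A=\chi_A(x)$ for every sequence $\{R_k\}$ of members of $\mathcal{B}$ containing $x$ whose diameters tend to $0$. The geometric maximal operator associated to $\mathcal{B}$ is $M_{\mathcal{B}}f(x)=\sup_{x\in R\in\mathcal{B}}\frac{1}{|R|}\int_R|f|$. The halo function $\phi$ of $\mathcal{B}$ is defined by $\phi(u)=u$ for $u\in[0,1]$ and, for $u\in(1,\infty)$, by $$\phi(u) = \sup \left\{\frac{1}{|A|}\left|\left\{x \in \mathbb{R} : M_{\mathcal{B}}\chi_{A}(x) > \frac{1}{u}\right\}\right|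 : A\subset\mathbb{R} \text{ measurable},\ 0 < |A| < \infty\right\}.$$ *)

theory Defs
  imports "HOL-Analysis.Analysis"
begin

definition homothety :: "real \<Rightarrow> real \<Rightarrow> real set \<Rightarrow> real set" where
  "homothety a r R = (\<lambda>y. a + r * y) ` R"

definition homothecy_invariant :: "real set set \<Rightarrow> bool" where
  "homothecy_invariant B \<longleftrightarrow> (\<forall>R\<in>B. \<forall>r>0. \<forall>a. homothety a r R \<in> B)"

(* The library's real-valued diameter carries no information on unbounded sets,
   hence the boundedness conditions.  A sequence whose extended diameters tend to 0
   is bounded from some index on, so none of the intended sequences is lost up to
   finitely many terms, which do not affect the limit. *)
definition density_basis :: "real set set \<Rightarrow> bool" where
  "density_basis B \<longleftrightarrow>
     (\<forall>R\<in>B. open R) \<and>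
     (\<forall>x. \<forall>\<delta>>0. \<exists>R\<in>B. x \<in> R \<and> bounded R \<and> diameter R < \<delta>) \<and>
     (\<forall>A\<in>sets lebesgue. AE x in lebesgue. \<forall>R :: nat \<Rightarrow> real set.
        (\<forall>k. R k \<in> B \<and> x \<in> R k \<and> bounded (R k)) \<longrightarrow>
        (\<lambda>k. diameter (R k)) \<longlonglongrightarrow> 0 \<longrightarrow>
        (\<lambda>k. 1 / measure lebesgue (R k) * (LINT y:R k|lebesgue. indicat_real A y))
          \<longlonglongrightarrow> indicat_real A x)"

definition maximal_operator :: "real set set \<Rightarrow> (real \<Rightarrow> real) \<Rightarrow> real \<Rightarrow> ennreal" where
  "maximal_operator B f x =
     (SUP R\<in>{R\<in>B. x \<in> R}.
        (\<integral>\<^sup>+y\<in>R. ennreal \<bar>f y\<bar> \<partial>lebesgue) / emeasure lebesgue R)"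

(* Only arguments u \<ge> 0 are meaningful. *)
definition halo_function :: "real set set \<Rightarrow> real \<Rightarrow> ennreal" where
  "halo_function B u =
     (if u \<le> 1 then ennreal u
      else SUP A\<in>{A\<in>sets lebesgue. 0 < emeasure lebesgue A \<and> emeasure lebesgue A < \<infinity>}.
        emeasure lebesgue {x. maximal_operator B (indicat_real A) x > ennreal (1 / u)}
          / emeasure lebesgue A)"

definition generating_sets :: "real set set" where
  "generating_sets = {({0<..<1} \<union> {x<..<x + \<epsilon>}) \<inter> {0<..<2} | x \<epsilon> :: real. 0 < \<epsilon> \<and> \<epsilon> < 1}"

definition example_basis :: "real set set" where
  "example_basis = {homothety a r S | a r S. r > 0 \<and> S \<in> generating_sets}"

end

(* Every R in the basis contains some interval (a, a + r) and is contained in (a, a + 2r),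
   so R fills a fixed fraction of a ball, centred at any given point of R, that contains R;
   hence Lebesgue's density theorem, a consequence of Vitali's covering theorem, carries over
   from balls to R.
   For the halo function, take A = (0,1).  Adding to A an interval of length epsilon around any
   point x of (0,2) gives a member of the basis that contains x and in which A has density at
   least 1 / (1 + epsilon); hence phi(u) >= 2 for every u > 1, whereas phi(1) = 1. *)
theory Submission
  imports Defs
begin

section \<open>Lebesgue's density theorem for balls\<close>

text \<open>One half of the density theorem; applied to a set and to its complement it yields the
  whole. The exceptional points form a countable union of sets \<open>N c\<close>, each negligible
  by a Vitali covering argument.\<close>

lemma AE_zero_density_outside:
  fixes A :: "'a::euclidean_space set"
  assumes A: "A \<in> sets lebesgue"
  shows "AE x in lebesgue. x \<notin> A \<longrightarrow>
    ((\<lambda>r. measure lebesgue (A \<inter> ball x r) / measure lebesgue (ball x r)) \<longlongrightarrow> 0) (at_right 0)"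
proof -
  \<comment> \<open>The points outside \<open>A\<close> at which \<open>A\<close> has relative
    density at least \<open>c\<close> in arbitrarily small balls. A point outside \<open>A\<close>
    where the limit 0 fails lies in some \<open>N c\<close>, and \<open>c\<close> can be shrunk to
    the form 1 / (n + 1), so countably many suffice.\<close>
  define N where "N c = {x. x \<notin> A \<and> (\<forall>\<delta>>0. \<exists>r. 0 < r \<and> r < \<delta> \<and>
      c * measure lebesgue (ball x r) \<le> measure lebesgue (A \<inter> ball x r))}" for c :: real
  have N: "negligible (N c)" if c: "c > 0" for c
    unfolding negligible_outer_le
  proof (intro allI impI)
    fix e :: real assume e: "e > 0"
    have "- A \<in> sets lebesgue"
      using A by (simp add: Compl_in_sets_lebesgue)
    \<comment> \<open>Approximating the complement of \<open>A\<close> from outside gives a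
      neighbourhood of every point of \<open>N c\<close> that meets \<open>A\<close> in measure less
      than \<open>c * e\<close>, even when \<open>A\<close> itself has infinite measure.\<close>
    then obtain T where T: "open T" "- A \<subseteq> T" "emeasure lebesgue (T - (- A)) < ennreal (c * e)"
      by (rule sets_lebesgue_outer_open[of _ "c * e"]) (use c e in auto)
    have TA: "T - (- A) = A \<inter> T" by blast
    define K where "K = {(x, r). ball x r \<subseteq> T \<and> 0 < r \<and>
      c * measure lebesgue (ball x r) \<le> measure lebesgue (A \<inter> ball x r)}"
    (* The balls in K form a Vitali cover of N c; disjoint ones have total measure at most
       the measure of A \<inter> T divided by c, which is less than e. *)
    have ex: "\<exists>i. i \<in> K \<and> x \<in> ball (fst i) (snd i) \<and> snd i < d" if x: "x \<in> N c" and d: "0 < d" for x d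
    proof -
      have "x \<in> T" using x T by (auto simp: N_def)
      then obtain \<rho> where \<rho>: "\<rho> > 0" "ball x \<rho> \<subseteq> T"
        using T(1) open_contains_ball by blast
      then obtain r where r: "0 < r" "r < min \<rho> d"
        "c * measure lebesgue (ball x r) \<le> measure lebesgue (A \<inter> ball x r)"
        using x d unfolding N_def mem_Collect_eq by (metis min_less_iff_conj)
      have "ball x r \<subseteq> T"
        using r \<rho> subset_ball[of r \<rho> x] by auto
      with r show ?thesis
        by (intro exI[of _ "(x, r)"]) (auto simp: K_def)
    qed
    obtain C where C: "countable C" "C \<subseteq> K"
      "pairwise (\<lambda>i j. disjnt (ball (fst i) (snd i)) (ball (fst j) (snd j))) C"
      "negligible (N c - (\<Union>i\<in>C. ball (fst i) (snd i)))"
      by (rule Vitali_covering_theorem_balls[of "N c" K fst snd, OF ex])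
    define U where "U = (\<Union>i\<in>C. ball (fst i) (snd i))"
    have U: "U \<in> sets lebesgue" unfolding U_def using C(1) by (intro sets.countable_UN') auto
    have disj: "disjoint_family_on (\<lambda>i. ball (fst i) (snd i)) C"
      using C(3) by (auto simp: disjoint_family_on_def pairwise_def disjnt_def)
    have "ennreal c * emeasure lebesgue U
        = (\<integral>\<^sup>+i. ennreal c * emeasure lebesgue (ball (fst i) (snd i)) \<partial>count_space C)"
      unfolding U_def using C(1) disj
      by (subst emeasure_UN_countable) (auto simp: nn_integral_cmult)
    also have "\<dots> \<le> (\<integral>\<^sup>+i. emeasure lebesgue (A \<inter> ball (fst i) (snd i)) \<partial>count_space C)"
    proof (rule nn_integral_mono)
      fix i assume "i \<in> space (count_space C)"
      then have "i \<in> K" using C by auto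
      then have le: "c * measure lebesgue (ball (fst i) (snd i))
          \<le> measure lebesgue (A \<inter> ball (fst i) (snd i))"
        by (auto simp: K_def)
      have "A \<inter> ball (fst i) (snd i) \<in> lmeasurable"
        using A by (intro bounded_set_imp_lmeasurable sets.Int bounded_Int) auto
      then show "ennreal c * emeasure lebesgue (ball (fst i) (snd i))
          \<le> emeasure lebesgue (A \<inter> ball (fst i) (snd i))"
        using le c by (simp add: emeasure_eq_measure2 flip: ennreal_mult)
    qed
    also have "\<dots> = emeasure lebesgue (\<Union>i\<in>C. A \<inter> ball (fst i) (snd i))"
      using C(1) A
      by (intro emeasure_UN_countable[symmetric] disjoint_family_on_bisimulation[OF disj]) auto
    also have "\<dots> \<le> emeasure lebesgue (A \<inter> T)"
      using C(2) A T(1) by (intro emeasure_mono sets.Int) (fastforce simp: K_def)+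
    also have "\<dots> \<le> ennreal c * ennreal e"
      using T(3) c e unfolding TA by (simp add: ennreal_mult[symmetric])
    finally have le: "emeasure lebesgue U \<le> ennreal e"
      using c by (subst (asm) ennreal_mult_le_mult_iff) auto
    then have Um: "U \<in> lmeasurable"
      using U by (intro fmeasurableI) (auto intro: le_less_trans)
    show "\<exists>V. N c \<subseteq> V \<and> V \<in> lmeasurable \<and> measure lebesgue V \<le> e"
    proof (intro exI conjI)
      \<comment> \<open>The disjoint balls cover \<open>N c\<close> only up to a negligible set,
        which is adjoined to \<open>U\<close> at no cost in measure.\<close>
      have D: "N c - U \<in> null_sets lebesgue"
        using C(4) by (simp add: U_def negligible_iff_null_sets)
      show "U \<union> (N c - U) \<in> lmeasurable"
        using C(4) by (intro fmeasurable.Un[OF Um] negligible_imp_measurable) (simp add: U_def)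
      have "measure lebesgue (U \<union> (N c - U)) = measure lebesgue U"
        by (rule measure_Un_null_set[OF U D])
      also have "\<dots> \<le> e"
        using le e by (simp add: measure_def enn2real_leI)
      finally show "measure lebesgue (U \<union> (N c - U)) \<le> e" .
    qed auto
  qed
  have "negligible (\<Union>n. N (inverse (real (Suc n))))"
    by (intro negligible_countable_Union) (auto intro!: N)
  then have "AE x in lebesgue. x \<notin> (\<Union>n. N (inverse (real (Suc n))))"
    by (intro AE_not_in) (simp add: negligible_iff_null_sets)
  then show ?thesis
  proof (rule AE_mp, intro AE_I2 impI)
    fix x assume x: "x \<notin> (\<Union>n. N (inverse (real (Suc n))))" "x \<notin> A"
    show "((\<lambda>r. measure lebesgue (A \<inter> ball x r) / measure lebesgue (ball x r)) \<longlongrightarrow> 0) (at_right 0)"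
    proof (rule tendstoI)
      fix e :: real assume "e > 0"
      then obtain n where n: "inverse (real (Suc n)) < e"
        using reals_Archimedean by blast
      have "x \<notin> N (inverse (real (Suc n)))" using x by blast
      then obtain \<delta> where \<delta>: "\<delta> > 0" "\<And>r. 0 < r \<Longrightarrow> r < \<delta> \<Longrightarrow>
          measure lebesgue (A \<inter> ball x r) < inverse (real (Suc n)) * measure lebesgue (ball x r)"
        using x(2) by (auto simp: N_def not_le)
      show "\<forall>\<^sub>F r in at_right 0.
          dist (measure lebesgue (A \<inter> ball x r) / measure lebesgue (ball x r)) 0 < e"
      proof (rule eventually_at_rightI[of 0 \<delta>])
        fix r assume r: "r \<in> {0<..<\<delta>}"
        then have "measure lebesgue (A \<inter> ball x r) / measure lebesgue (ball x r) < inverse (real (Suc n))"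
          using \<delta>(2)[of r] content_ball_pos[of r x] by (simp add: divide_less_eq)
        then show "dist (measure lebesgue (A \<inter> ball x r) / measure lebesgue (ball x r)) 0 < e"
          using n by simp
      qed (use \<delta> in auto)
    qed
  qed
qed

section \<open>Transfer of density from balls to sets with diameter bounded by measure\<close>

text \<open>\<open>R k\<close> lies in a ball around \<open>x\<close> of measure
  \<open>4 * diameter (R k)\<close>, hence at most \<open>4 * C\<close> times the measure of
  \<open>R k\<close>. The relative density of \<open>A\<close> in \<open>R k\<close> is thus at most
  \<open>4 * C\<close> times that in the ball.\<close>

lemma zero_density_comparable_sets:
  fixes R :: "nat \<Rightarrow> real set"
  assumes A: "A \<in> sets lebesgue" and C: "C \<ge> 0"
    and lim: "((\<lambda>r. measure lebesgue (A \<inter> ball x r) / measure lebesgue (ball x r)) \<longlongrightarrow> 0) (at_right 0)"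
    and R: "\<And>k. open (R k)" "\<And>k. x \<in> R k" "\<And>k. bounded (R k)"
      "\<And>k. diameter (R k) \<le> C * measure lebesgue (R k)"
    and diam: "(\<lambda>k. diameter (R k)) \<longlonglongrightarrow> 0"
  shows "(\<lambda>k. measure lebesgue (A \<inter> R k) / measure lebesgue (R k)) \<longlonglongrightarrow> 0"
proof -
  \<comment> \<open>Points of \<open>R k\<close> may be at distance exactly
    \<open>diameter (R k)\<close> from \<open>x\<close>; doubling the radius puts them in the open
    ball.\<close>
  define d where "d k = 2 * diameter (R k)" for k
  \<comment> \<open>An open set is never a single point. Positive radii are what allows
    \<open>lim\<close>, a limit along \<open>at_right 0\<close>, to be composed with
    \<open>d\<close>.\<close>
  have dpos: "diameter (R k) > 0" for k
  proof -
    have "R k \<noteq> {x}" using R(1)[of k] not_open_singleton by metis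
    then obtain y where "y \<in> R k" "y \<noteq> x" using R(2)[of k] by blast
    then show ?thesis
      using diameter_bounded_bound[OF R(3)[of k] \<open>y \<in> R k\<close> R(2)[of k]]
      by (metis dist_eq_0_iff le_less_trans not_less zero_le_dist order.order_iff_strict)
  qed
  have mpos: "measure lebesgue (R k) > 0" for k
    using R(4)[of k] dpos[of k] by (cases "measure lebesgue (R k) = 0") (auto simp: zero_less_measure_iff)
  have "d \<longlonglongrightarrow> 0" unfolding d_def using tendsto_mult_right_zero[OF diam] by simp
  then have "filterlim d (at_right 0) sequentially"
    using dpos by (auto simp: filterlim_at d_def less_imp_neq[symmetric])
  then have lim': "(\<lambda>k. 4 * C * (measure lebesgue (A \<inter> ball x (d k)) / measure lebesgue (ball x (d k)))) \<longlonglongrightarrow> 0"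
    by (intro tendsto_mult_right_zero filterlim_compose[OF lim])
  show ?thesis
  proof (rule tendsto_sandwich[OF _ _ tendsto_const lim'])
    show "\<forall>\<^sub>F k in sequentially. measure lebesgue (A \<inter> R k) / measure lebesgue (R k)
       \<le> 4 * C * (measure lebesgue (A \<inter> ball x (d k)) / measure lebesgue (ball x (d k)))"
    proof (rule always_eventually, rule allI)
      fix k
      have sub: "R k \<subseteq> ball x (d k)"
      proof
        fix y assume "y \<in> R k"
        then have "dist x y \<le> diameter (R k)"
          by (rule diameter_bounded_bound[OF R(3) R(2)])
        then show "y \<in> ball x (d k)" using dpos[of k] by (simp add: d_def)
      qed
      have "A \<inter> ball x (d k) \<in> lmeasurable"
        using A by (intro bounded_set_imp_lmeasurable sets.Int bounded_Int) auto
      then have "measure lebesgue (A \<inter> R k) \<le> measure lebesgue (A \<inter> ball x (d k))"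
        using sub A R(1)[of k] by (intro measure_mono_fmeasurable sets.Int) auto
      moreover have "measure lebesgue (ball x (d k)) = 4 * diameter (R k)"
        using dpos[of k] by (simp add: ball_eq_greaterThanLessThan d_def)
      moreover have "1 / measure lebesgue (R k) \<le> C / diameter (R k)"
        using R(4)[of k] mpos[of k] dpos[of k] by (simp add: field_simps)
      ultimately have "measure lebesgue (A \<inter> R k) * (1 / measure lebesgue (R k))
          \<le> measure lebesgue (A \<inter> ball x (d k)) * (C / diameter (R k))"
        using mpos[of k] by (intro mult_mono) auto
      then show "measure lebesgue (A \<inter> R k) / measure lebesgue (R k)
         \<le> 4 * C * (measure lebesgue (A \<inter> ball x (d k)) / measure lebesgue (ball x (d k)))"
        using \<open>measure lebesgue (ball x (d k)) = 4 * diameter (R k)\<close>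
        by (simp add: mult.commute)
    qed
  qed (use mpos in auto)
qed

text \<open>Almost every \<open>x\<close> is a point of zero density for whichever of
  \<open>A\<close> and \<open>- A\<close> omits it, and this carries over to the sets
  \<open>R k\<close>. For \<open>x\<close> in \<open>A\<close> the claim follows because the
  densities of \<open>A\<close> and \<open>- A\<close> in \<open>R k\<close> add up to 1.\<close>

lemma density_basis_if_diameter_le_measure:
  assumes op: "\<And>R. R \<in> B \<Longrightarrow> open R"
    and small: "\<And>x \<delta>. \<delta> > 0 \<Longrightarrow> \<exists>R\<in>B. x \<in> R \<and> bounded R \<and> diameter R < \<delta>"
    and C: "C \<ge> 0" "\<And>R. R \<in> B \<Longrightarrow> bounded R \<Longrightarrow> diameter R \<le> C * measure lebesgue R"
  shows "density_basis B"
  unfolding density_basis_def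
proof (intro conjI ballI allI impI)
  fix A :: "real set" assume A: "A \<in> sets lebesgue"
  then have A': "- A \<in> sets lebesgue" by (simp add: Compl_in_sets_lebesgue)
  show "AE x in lebesgue. \<forall>R :: nat \<Rightarrow> real set.
        (\<forall>k. R k \<in> B \<and> x \<in> R k \<and> bounded (R k)) \<longrightarrow>
        (\<lambda>k. diameter (R k)) \<longlonglongrightarrow> 0 \<longrightarrow>
        (\<lambda>k. 1 / measure lebesgue (R k) * (LINT y:R k|lebesgue. indicat_real A y))
          \<longlonglongrightarrow> indicat_real A x"
    using AE_zero_density_outside[OF A] AE_zero_density_outside[OF A']
  proof eventually_elim
    case (elim x)
    show ?case
    proof (intro allI impI)
      fix R :: "nat \<Rightarrow> real set"
      assume R: "\<forall>k. R k \<in> B \<and> x \<in> R k \<and> bounded (R k)"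
        and diam: "(\<lambda>k. diameter (R k)) \<longlonglongrightarrow> 0"
      have Rm: "R k \<in> lmeasurable" for k
        using R op by (intro lmeasurable_open) auto
      have mpos: "measure lebesgue (R k) > 0" for k
      proof -
        have "\<not> negligible (R k)" using R op by (intro open_not_negligible) auto
        then have "measure lebesgue (R k) \<noteq> 0" using negligible_iff_measure0[OF Rm] by blast
        then show ?thesis by (simp add: zero_less_measure_iff)
      qed
      have avg: "1 / measure lebesgue (R k) * (LINT y:R k|lebesgue. indicat_real A y)
          = measure lebesgue (A \<inter> R k) / measure lebesgue (R k)" for k
      proof -
        have "(LINT y:R k|lebesgue. indicat_real A y) = (LINT y|lebesgue. indicat_real (A \<inter> R k) y)"
          unfolding set_lebesgue_integral_def
          by (rule Bochner_Integration.integral_cong) (auto simp: indicator_def)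
        then show ?thesis by simp
      qed
      have lim: "(\<lambda>k. measure lebesgue (E \<inter> R k) / measure lebesgue (R k)) \<longlonglongrightarrow> 0"
        if "E \<in> sets lebesgue"
          "((\<lambda>r. measure lebesgue (E \<inter> ball x r) / measure lebesgue (ball x r)) \<longlongrightarrow> 0) (at_right 0)" for E
        using that R op C diam by (intro zero_density_comparable_sets[where C = C]) auto
      show "(\<lambda>k. 1 / measure lebesgue (R k) * (LINT y:R k|lebesgue. indicat_real A y))
          \<longlonglongrightarrow> indicat_real A x"
      proof (cases "x \<in> A")
        case False
        then show ?thesis using elim lim[OF A] by (simp add: avg del: times_divide_eq_left)
      next
        case True
        then have "(\<lambda>k. 1 - measure lebesgue (- A \<inter> R k) / measure lebesgue (R k)) \<longlonglongrightarrow> 1 - 0"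
          using elim by (intro tendsto_diff tendsto_const lim[OF A']) auto
        moreover have "1 - measure lebesgue (- A \<inter> R k) / measure lebesgue (R k)
            = measure lebesgue (A \<inter> R k) / measure lebesgue (R k)" for k
        proof -
          have "measure lebesgue ((R k \<inter> A) \<union> R k)
              = measure lebesgue (R k \<inter> A) + measure lebesgue (R k - (R k \<inter> A))"
            using Rm[of k] A by (intro measure_Un2 fmeasurable_Int_fmeasurable) auto
          moreover have "(R k \<inter> A) \<union> R k = R k" "R k - (R k \<inter> A) = - A \<inter> R k" "R k \<inter> A = A \<inter> R k"
            by auto
          ultimately show ?thesis using mpos[of k] by (simp add: field_simps)
        qed
        ultimately show ?thesis using True by (simp add: avg del: times_divide_eq_left)
      qed
    qed
  qed
qed (use op small in auto)

section \<open>Geometry of the example basis\<close>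

lemma homothety_homothety: "homothety a r (homothety b s R) = homothety (a + r * b) (r * s) R"
  by (auto simp: homothety_def image_image algebra_simps)

lemma homothecy_invariant_example_basis: "homothecy_invariant example_basis"
  unfolding homothecy_invariant_def example_basis_def
  by (fastforce simp: homothety_homothety)

text \<open>Every generating set lies between (0,1) and (0,2), and homotheties preserve such
  inclusions.\<close>

lemma example_basis_geometry:
  assumes "R \<in> example_basis"
  obtains a r where "r > 0" "open R" "{a<..<a + r} \<subseteq> R" "R \<subseteq> {a<..<a + 2 * r}"
proof -
  obtain a r S where R: "R = homothety a r S" "r > 0" "S \<in> generating_sets"
    using assms by (auto simp: example_basis_def)
  then have S: "open S" "{0<..<1} \<subseteq> S" "S \<subseteq> {0<..<2}"
    by (auto simp: generating_sets_def intro!: open_Int open_Un)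
  have img: "(\<lambda>y. a + r * y) ` {0<..<t} = {a<..<a + r * t}" for t
  proof (intro set_eqI iffI)
    fix z assume "z \<in> {a<..<a + r * t}"
    then have "(z - a) / r \<in> {0<..<t}" "z = a + r * ((z - a) / r)"
      using R(2) by (auto simp: field_simps)
    then show "z \<in> (\<lambda>y. a + r * y) ` {0<..<t}" by blast
  qed (use R(2) in auto)
  show ?thesis
  proof
    show "open R"
      unfolding R homothety_def using R(2) S(1) open_affinity[of S r a] by simp
    show "{a<..<a + r} \<subseteq> R" "R \<subseteq> {a<..<a + 2 * r}"
      using image_mono[OF S(2), of "\<lambda>y. a + r * y"] image_mono[OF S(3), of "\<lambda>y. a + r * y"]
      unfolding R homothety_def img by (simp_all add: mult.commute)
  qed fact
qed

text \<open>The constant 2 is the ratio of the lengths of the outer interval (a, a + 2r) and the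
  inner interval (a, a + r).\<close>

lemma density_basis_example_basis: "density_basis example_basis"
proof (rule density_basis_if_diameter_le_measure[where C = 2])
  fix R assume "R \<in> example_basis"
  then show "open R" by (rule example_basis_geometry)
next
  fix R assume "R \<in> example_basis"
  then obtain a r where R: "r > 0" "open R" "{a<..<a + r} \<subseteq> R" "R \<subseteq> {a<..<a + 2 * r}"
    by (rule example_basis_geometry)
  have "diameter R \<le> diameter {a<..<a + 2 * r}"
    using R by (intro diameter_subset) auto
  also have "\<dots> = 2 * measure lebesgue {a<..<a + r}"
    using R(1) by simp
  also have "\<dots> \<le> 2 * measure lebesgue R"
    using R by (intro mult_left_mono measure_mono_fmeasurable lmeasurable_open)
      (auto intro: bounded_subset[OF _ R(4)])
  finally show "diameter R \<le> 2 * measure lebesgue R" .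
next
  fix x \<delta> :: real assume "\<delta> > 0"
  define r where "r = \<delta> / 4"
  \<comment> \<open>The added interval (1/4, 3/4) is absorbed by (0,1), so the copies of
    \<open>S\<close> are plain intervals. With \<open>r\<close> equal to a quarter of \<delta>, the
    enclosing interval \<open>{x - r..x + r}\<close> has length \<delta>/2.\<close>
  define S :: "real set" where "S = ({0<..<1} \<union> {1/4<..<1/4 + 1/2}) \<inter> {0<..<2}"
  have "S \<in> generating_sets"
    unfolding S_def generating_sets_def by (intro CollectI exI[of _ "1/4"] exI[of _ "1/2"]) auto
  then have mem: "homothety (x - r / 2) r S \<in> example_basis"
    using \<open>\<delta> > 0\<close> unfolding example_basis_def r_def by force
  have S: "S = {0<..<1}" by (auto simp: S_def)
  have "x \<in> homothety (x - r / 2) r S"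
    unfolding S homothety_def by (intro image_eqI[of _ _ "1/2"]) auto
  moreover have sub: "homothety (x - r / 2) r S \<subseteq> {x - r..x + r}"
    using \<open>\<delta> > 0\<close> by (auto simp: S homothety_def r_def field_simps)
  moreover have "diameter (homothety (x - r / 2) r S) < \<delta>"
    using diameter_subset[OF sub] \<open>\<delta> > 0\<close> by (simp add: r_def)
  moreover have "bounded (homothety (x - r / 2) r S)"
    by (rule bounded_subset[OF bounded_closed_interval sub])
  ultimately show "\<exists>R\<in>example_basis. x \<in> R \<and> bounded R \<and> diameter R < \<delta>"
    using mem by auto
qed simp

section \<open>Lower bound for the halo function and discontinuity at 1\<close>

text \<open>The superlevel set is the union of the members of \<open>B\<close> on which the average
  exceeds \<open>t\<close>. Openness supplies its measurability, on which monotonicity of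
  \<open>emeasure\<close> relies when the set is bounded from below.\<close>

lemma open_maximal_operator_superlevel:
  assumes "\<And>R. R \<in> B \<Longrightarrow> open R"
  shows "open {x. maximal_operator B f x > t}"
proof -
  have "{x. maximal_operator B f x > t} =
      \<Union>{R \<in> B. t < (\<integral>\<^sup>+y\<in>R. ennreal \<bar>f y\<bar> \<partial>lebesgue) / emeasure lebesgue R}"
    by (auto simp: maximal_operator_def less_SUP_iff)
  then show ?thesis using assms by auto
qed

lemma maximal_operator_unit_interval_gt:
  assumes u: "u > 1" and x: "0 < x" "x < 2"
  shows "maximal_operator example_basis (indicat_real {0<..<1}) x > ennreal (1 / u)"
proof -
  \<comment> \<open>The bound 1/2 keeps \<epsilon> below 1, as generating sets demand; the bound (u
    - 1)/2 makes 1 + \<epsilon> < u, hence 1/u < 1/(1 + \<epsilon>).\<close>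
  define \<epsilon> where "\<epsilon> = min (1/2) ((u - 1) / 2)"
  have \<epsilon>: "0 < \<epsilon>" "\<epsilon> < 1" "1 + \<epsilon> < u"
    using u by (auto simp: \<epsilon>_def min_def field_simps)
  \<comment> \<open>The added interval is centred at \<open>x\<close>; cutting with (0,2) keeps
    \<open>x\<close>, since 0 < x < 2.\<close>
  define y where "y = x - \<epsilon> / 2"
  define S where "S = ({0<..<1} \<union> {y<..<y + \<epsilon>}) \<inter> {0<..<2}"
  have S: "x \<in> S" "{0<..<1} \<subseteq> S" using x \<epsilon> by (auto simp: S_def y_def)
  have "S \<in> generating_sets"
    using \<epsilon> unfolding S_def generating_sets_def by blast
  moreover have "homothety 0 1 S = S" by (simp add: homothety_def)
  ultimately have mem: "S \<in> {R \<in> example_basis. x \<in> R}"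
    using S unfolding example_basis_def by (metis (mono_tags, lifting) mem_Collect_eq zero_less_one)
  have "emeasure lebesgue S \<le> emeasure lebesgue ({0<..<1} \<union> {y<..<y + \<epsilon>})"
    by (intro emeasure_mono) (auto simp: S_def)
  also have "\<dots> \<le> emeasure lebesgue {0<..<1::real} + emeasure lebesgue {y<..<y + \<epsilon>}"
    by (intro emeasure_subadditive) auto
  also have "\<dots> = ennreal (1 + \<epsilon>)"
    using \<epsilon> by (simp flip: ennreal_plus ennreal_1)
  finally have Sle: "emeasure lebesgue S \<le> ennreal (1 + \<epsilon>)" .
  have "(\<lambda>z. ennreal \<bar>indicat_real {0<..<1} z\<bar> * indicator S z) = indicator {0<..<1}"
    using S(2) by (auto simp: indicator_def fun_eq_iff)
  then have int: "(\<integral>\<^sup>+z\<in>S. ennreal \<bar>indicat_real {0<..<1} z\<bar> \<partial>lebesgue) = 1"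
    by simp
  have "ennreal (1 / u) < ennreal (1 / (1 + \<epsilon>))"
    using \<epsilon> by (intro ennreal_lessI) (auto simp: field_simps)
  also have "\<dots> = 1 / ennreal (1 + \<epsilon>)"
    using \<epsilon> by (simp add: divide_ennreal del: ennreal_plus flip: ennreal_1)
  also have "\<dots> \<le> 1 / emeasure lebesgue S"
  \<comment> \<open>In \<open>ennreal\<close>, 1 / 0 is the top element, which settles
    \<open>s = 0\<close>; an infinite measure contradicts \<open>Sle\<close>.\<close>
  proof (cases "emeasure lebesgue S")
    case (real s)
    then show ?thesis
      using Sle \<epsilon> by (cases "s = 0") (auto simp: divide_ennreal frac_le simp del: ennreal_plus simp flip: ennreal_1)
  qed (use Sle in \<open>auto simp: top_unique\<close>)
  also have "\<dots> = (\<integral>\<^sup>+z\<in>S. ennreal \<bar>indicat_real {0<..<1} z\<bar> \<partial>lebesgue) / emeasure lebesgue S"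
    by (simp only: int)
  also have "\<dots> \<le> maximal_operator example_basis (indicat_real {0<..<1}) x"
    unfolding maximal_operator_def by (rule SUP_upper[OF mem])
  finally show ?thesis .
qed

text \<open>The single test set (0,1) serves every u > 1: its superlevel set always contains (0,2),
  so the bound does not decay as u approaches 1.\<close>

lemma halo_function_example_basis_ge_2:
  assumes u: "u > 1"
  shows "halo_function example_basis u \<ge> 2"
proof -
  let ?A = "{0<..<1::real}"
  let ?E = "{x. maximal_operator example_basis (indicat_real ?A) x > ennreal (1 / u)}"
  have "open ?E"
    by (rule open_maximal_operator_superlevel) (rule example_basis_geometry)
  have "2 = emeasure lebesgue {0<..<2::real}" by simp
  also have "\<dots> \<le> emeasure lebesgue ?E"
    using maximal_operator_unit_interval_gt[OF u] \<open>open ?E\<close> by (intro emeasure_mono) auto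
  also have "\<dots> = emeasure lebesgue ?E / emeasure lebesgue ?A"
    by (simp add: divide_ennreal_def)
  also have "\<dots> \<le> (SUP A\<in>{A\<in>sets lebesgue. 0 < emeasure lebesgue A \<and> emeasure lebesgue A < \<infinity>}.
        emeasure lebesgue {x. maximal_operator example_basis (indicat_real A) x > ennreal (1 / u)}
          / emeasure lebesgue A)"
    by (rule SUP_upper) auto
  finally show ?thesis using u by (simp add: halo_function_def)
qed

theorem mainTheorem2:
  "homothecy_invariant example_basis \<and>
   density_basis example_basis \<and>
   \<not> continuous (at 1 within {0..}) (halo_function example_basis)"
proof (intro conjI homothecy_invariant_example_basis density_basis_example_basis notI)
  assume "continuous (at 1 within {0..}) (halo_function example_basis)"
  then have "(halo_function example_basis \<longlongrightarrow> 1) (at 1 within {0..})"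
    by (simp add: continuous_within halo_function_def)
  \<comment> \<open>The value 1 at u = 1 comes from the first branch of the definition, while the
    bound 2 holds for u > 1; hence the restriction to the right-hand filter, which is
    nontrivial.\<close>
  then have "(halo_function example_basis \<longlongrightarrow> 1) (at_right 1)"
    by (rule tendsto_within_subset) auto
  then have "\<forall>\<^sub>F u in at_right 1. halo_function example_basis u < 2"
    by (rule order_tendstoD) simp
  moreover have "\<forall>\<^sub>F u::real in at_right 1. u > 1"
    by (simp add: eventually_at_filter)
  ultimately have "\<forall>\<^sub>F u::real in at_right 1. False"
    by eventually_elim (use halo_function_example_basis_ge_2 in \<open>auto simp: not_less[symmetric]\<close>)
  then show False by simp
qed

end
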